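(* Let $n\geq m\geq 1$ be integers, let $K$ be a field, $S=K[x_1,\ldots,x_{n+m}]$ and $I=(x_1,\ldots,x_n)\cap(x_{n+1},\ldots,x_{n+m})\subset S$. Then $$\operatorname{sdepth}(S/I)\leq \operatorname{hdepth}(S/I)\leq \left\lfloor n+m+\frac12-\sqrt{2mn+\frac14}\right\rfloor.$$ In particular, if $n\leq 2m-2$ then $\operatorname{hdepth}(S/I)<m$.
   Context: Stanley depth: let $S=K[x_1,\ldots,x_p]$ be a polynomial ring over a field $K$ and $M$ a $\mathbb Z^p$-graded $S$-module. A Stanley decomposition of $M$ is a direct sum decomposition $\mathcal D: M=\bigoplus_{i=1}^r m_iK[Z_i]$ as a $\mathbb Z^p$-graded $K$-vector space, where each $m_i\in M$ is homogeneous with respect to the $\mathbb Z^p$-grading, $Z_i\subset\{x_1,\ldots,x_p\}$, and $m_iK[Z_i]=\{um_i: u\in K[Z_i]\}\subset M$ is a free $K[Z_i]$-submodule. Put $\operatorname{sdepth}(\mathcal D)=\min_i|Z_i|$ and $\operatorname{sdepth}(M)=\max\{\operatorname{sdepth}(\mathcal D):\mathcal D$ a Stanley decomposition of $M\}$. Hilbert depth: for a finitely generated graded $S$-module $M$, $\operatorname{hdepth}(M)$ is the maximal depth of a finitely generated graded $S$-module with the same Hilbert series as $M$. For squarefree monomial ideals $A\subset B\subset S$ this is (by a known theorem, usable as the definition) $\operatorname{hdepth}(B/A)=\max\{d\in\{0,\ldots,p\}:\beta_k^d(B/A)\geq 0\text{ for all }0\leq k\leq d\}$, where $\beta_k^d(B/A)=\sum_{j=0}^k(-1)^{k-j}\binom{d-j}{k-j}\alpha_j(B/A)$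 and $\alpha_j(B/A)$ is the number of squarefree monomials of degree $j$ in $B\setminus A$. *)

theory Defs
  imports Complex_Main "HOL-Library.Poly_Mapping" "HOL-Library.FuncSet" "HOL-Algebra.Module"
    "HOL-Algebra.QuotRing"
begin

text \<open>
  Exponent vectors are finitely supported functions from variable indices to naturals, and
  polynomials are finitely supported functions from exponent vectors to coefficients;
  addition and multiplication (convolution) are those of the library instance.
  The variables of a polynomial ring in \<open>p\<close> variables have the indices \<open>1, \<dots>, p\<close>, and a set of
  variables is given by the set of its indices.
\<close>

type_synonym expo = "nat \<Rightarrow>\<^sub>0 nat"
type_synonym 'k mpoly = "expo \<Rightarrow>\<^sub>0 'k"

definition pvar :: "nat \<Rightarrow> 'k::field mpoly" where
  "pvar i = Poly_Mapping.single (Poly_Mapping.single i 1) 1"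

definition polys_in :: "nat set \<Rightarrow> 'k::field mpoly set" where
  "polys_in Z = {f. \<forall>t\<in>Poly_Mapping.keys f. Poly_Mapping.keys t \<subseteq> Z}"

definition poly_ring :: "nat \<Rightarrow> 'k::field mpoly ring" where
  "poly_ring p =
    \<lparr>carrier = polys_in {1..p}, mult = (*), one = 1, zero = 0, add = (+)\<rparr>"

text \<open>The ring \<open>R/I\<close> regarded as an \<open>R\<close>-module.\<close>

definition quot_module :: "'a ring \<Rightarrow> 'a set \<Rightarrow> ('a, 'a set) module" where
  "quot_module R I =
    \<lparr>carrier = carrier (R Quot I), mult = mult (R Quot I), one = one (R Quot I),
     zero = zero (R Quot I), add = add (R Quot I),
     smult = (\<lambda>r X. (I +>\<^bsub>R\<^esub> r) \<otimes>\<^bsub>R Quot I\<^esub> X)\<rparr>"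

text \<open>
  The group of degrees \<open>\<int>\<^sup>p\<close> is the set of integer functions vanishing outside \<open>{1..p}\<close>.
  A grading assigns to each degree the corresponding homogeneous component.
\<close>

type_synonym zdeg = "nat \<Rightarrow> int"

definition zdegs :: "nat \<Rightarrow> zdeg set" where
  "zdegs p = {a. \<forall>i. i \<notin> {1..p} \<longrightarrow> a i = 0}"

definition poly_grading :: "nat \<Rightarrow> zdeg \<Rightarrow> 'k::field mpoly set" where
  "poly_grading p a =
    {f \<in> polys_in {1..p}. \<forall>t\<in>Poly_Mapping.keys f. \<forall>i. int (Poly_Mapping.lookup t i) = a i}"

definition quot_grading :: "nat \<Rightarrow> 'k::field mpoly set \<Rightarrow> zdeg \<Rightarrow> 'k mpoly set set" where
  "quot_grading p I a = (\<lambda>f. I +>\<^bsub>poly_ring p\<^esub> f) ` poly_grading p a"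

definition stanley_space ::
  "('k::field mpoly, 'b) module \<Rightarrow> 'b \<Rightarrow> nat set \<Rightarrow> 'b set" where
  "stanley_space M m Z = (\<lambda>u. u \<odot>\<^bsub>M\<^esub> m) ` polys_in Z"

text \<open>
  Let \<open>M\<close> be a module over \<open>poly_ring p\<close> that is \<open>\<int>\<^sup>p\<close>-graded by \<open>G\<close>. A Stanley decomposition is
  a list of pairs \<open>(m\<^sub>i, Z\<^sub>i)\<close>. As \<open>m\<^sub>i K[Z\<^sub>i]\<close> is generated by \<open>m\<^sub>i\<close>, it is free with basis \<open>m\<^sub>i\<close>
  iff \<open>m\<^sub>i\<close> has zero annihilator in \<open>K[Z\<^sub>i]\<close>; in particular \<open>m\<^sub>i \<noteq> 0\<close>.
  The last conjunct says that \<open>M\<close> is the direct sum of the spaces \<open>m\<^sub>i K[Z\<^sub>i]\<close>. These are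
  graded subspaces because the \<open>m\<^sub>i\<close> are homogeneous, so the sum is one of graded vector spaces.
\<close>

definition stanley_decomposition ::
  "nat \<Rightarrow> ('k::field mpoly, 'b) module \<Rightarrow> (zdeg \<Rightarrow> 'b set) \<Rightarrow> ('b \<times> nat set) list \<Rightarrow> bool"
where
  "stanley_decomposition p M G D \<longleftrightarrow>
    (\<forall>(m, Z) \<in> set D.
      m \<in> carrier M \<and> (\<exists>a\<in>zdegs p. m \<in> G a) \<and> Z \<subseteq> {1..p} \<and>
      (\<forall>u\<in>polys_in Z. u \<odot>\<^bsub>M\<^esub> m = \<zero>\<^bsub>M\<^esub> \<longrightarrow> u = 0)) \<and>
    (\<forall>x\<in>carrier M.
      \<exists>!f. f \<in> (\<Pi>\<^sub>E i\<in>{..<length D}. stanley_space M (fst (D ! i)) (snd (D ! i))) \<and>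
           x = (\<Oplus>\<^bsub>M\<^esub>i\<in>{..<length D}. f i))"

definition sdepth_decomp :: "('b \<times> nat set) list \<Rightarrow> nat" where
  "sdepth_decomp D = Min ((\<lambda>(m, Z). card Z) ` set D)"

definition sdepth :: "nat \<Rightarrow> ('k::field mpoly, 'b) module \<Rightarrow> (zdeg \<Rightarrow> 'b set) \<Rightarrow> nat" where
  "sdepth p M G = Max {sdepth_decomp D |D. stanley_decomposition p M G D}"

text \<open>
  For squarefree monomial ideals \<open>A \<subseteq> B\<close>, \<open>sqfree_count p A B j\<close> is the number \<open>\<alpha>\<^sub>j(B/A)\<close>,
  \<open>hbeta p A B d k\<close> is \<open>\<beta>\<^sub>k\<^sup>d(B/A)\<close> (meaningful for \<open>k \<le> d\<close>), and \<open>hdepth p A B\<close> is the Hilbert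
  depth of \<open>B/A\<close> in its combinatorial description.
\<close>

definition sqfree_count :: "nat \<Rightarrow> 'k::field mpoly set \<Rightarrow> 'k mpoly set \<Rightarrow> nat \<Rightarrow> nat" where
  "sqfree_count p A B j =
    card {t :: expo. Poly_Mapping.keys t \<subseteq> {1..p} \<and> (\<forall>i. Poly_Mapping.lookup t i \<le> 1) \<and>
      (\<Sum>i\<in>Poly_Mapping.keys t. Poly_Mapping.lookup t i) = j \<and>
      Poly_Mapping.single t 1 \<in> B - A}"

definition hbeta :: "nat \<Rightarrow> 'k::field mpoly set \<Rightarrow> 'k mpoly set \<Rightarrow> nat \<Rightarrow> nat \<Rightarrow> int" where
  "hbeta p A B d k =
    (\<Sum>j=0..k. (-1) ^ (k - j) * int ((d - j) choose (k - j)) * int (sqfree_count p A B j))"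

definition hdepth :: "nat \<Rightarrow> 'k::field mpoly set \<Rightarrow> 'k mpoly set \<Rightarrow> nat" where
  "hdepth p A B = Max {d \<in> {0..p}. \<forall>k\<in>{0..d}. 0 \<le> hbeta p A B d k}"

end

theory Submission
  imports Defs
begin

text \<open>
  The homogeneous components of \<open>S/I\<close> have dimension at most one, so a Stanley decomposition is
  the same thing as a partition of the exponents of the monomials outside \<open>I\<close> into cones
  \<open>b + \<nat>\<^bsup>Z\<^esup>\<close>. Such a cone meets the squarefree monomials, viewed as sets of variables, in the
  interval from \<open>supp b\<close> to \<open>supp b \<union> Z\<close>, or not at all if \<open>b\<close> is not squarefree. If \<open>d \<le> |Z|\<close>
  for all cones, the contribution of each interval to \<open>\<beta>\<^sub>k\<^sup>d\<close> is nonnegative, which bounds the Stanley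
  depth by the Hilbert depth. The numerical bound is the single condition \<open>\<beta>\<^sub>2\<^sup>d \<ge> 0\<close> (for \<open>d \<ge> 2\<close>):
  since \<open>\<alpha>\<^sub>0 = 1\<close> and \<open>\<alpha>\<^sub>j = (n choose j) + (m choose j)\<close> for \<open>j \<ge> 1\<close>, it is a quadratic inequality
  in \<open>d\<close> whose roots are \<open>n + m + 1/2 \<plusminus> sqrt (2mn + 1/4)\<close>.
\<close>

section \<open>Polynomials supported on a set of exponents\<close>

abbreviation exps :: "nat \<Rightarrow> expo set" where
  "exps p \<equiv> {t. Poly_Mapping.keys t \<subseteq> {1..p}}"

definition monomial_space :: "expo set \<Rightarrow> 'k::field mpoly set" where
  "monomial_space N = {f. Poly_Mapping.keys f \<subseteq> N}"

definition cone :: "expo \<Rightarrow> nat set \<Rightarrow> expo set" where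
  "cone b Z = {b + v |v. Poly_Mapping.keys v \<subseteq> Z}"

definition restrict_keys :: "expo set \<Rightarrow> 'k::field mpoly \<Rightarrow> 'k mpoly" where
  "restrict_keys A f =
    (\<Sum>t \<in> Poly_Mapping.keys f \<inter> A. Poly_Mapping.single t (Poly_Mapping.lookup f t))"

definition cone_partition :: "expo set \<Rightarrow> (expo \<times> nat set) list \<Rightarrow> bool" where
  "cone_partition P C \<longleftrightarrow> (\<forall>(b, Z) \<in> set C. cone b Z \<subseteq> P) \<and>
    (\<forall>t\<in>P. \<exists>!i. i < length C \<and> t \<in> cone (fst (C ! i)) (snd (C ! i)))"

lemma cone_partition_subset: "cone_partition P C \<Longrightarrow> (b, Z) \<in> set C \<Longrightarrow> cone b Z \<subseteq> P"
  unfolding cone_partition_def by fast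

lemma keys_expo_add: "Poly_Mapping.keys (s + t :: expo) = Poly_Mapping.keys s \<union> Poly_Mapping.keys t"
  by (auto simp: in_keys_iff lookup_add)

lemma lookup_restrict_keys:
  "Poly_Mapping.lookup (restrict_keys A f) t = (if t \<in> A then Poly_Mapping.lookup f t else 0)"
  by (auto simp: restrict_keys_def lookup_sum lookup_single when_def in_keys_iff)

lemma sum_monomials: "(\<Sum>t \<in> Poly_Mapping.keys f. Poly_Mapping.single t (Poly_Mapping.lookup f t)) = f"
  by (rule poly_mapping_eqI) (auto simp: lookup_sum lookup_single when_def in_keys_iff)

lemma polys_in_eq: "polys_in Z = monomial_space {t. Poly_Mapping.keys t \<subseteq> Z}"
  by (auto simp: polys_in_def monomial_space_def)

lemma monomial_space_zero [simp]: "0 \<in> monomial_space N"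
  by (simp add: monomial_space_def)

lemma monomial_space_add: "f \<in> monomial_space N \<Longrightarrow> g \<in> monomial_space N \<Longrightarrow> f + g \<in> monomial_space N"
  using keys_add[of f g] by (auto simp: monomial_space_def)

lemma polys_in_add: "f \<in> polys_in Z \<Longrightarrow> g \<in> polys_in Z \<Longrightarrow> f + g \<in> polys_in Z"
  by (simp add: polys_in_eq monomial_space_add)

lemma monomial_space_uminus: "f \<in> monomial_space N \<Longrightarrow> - f \<in> monomial_space N"
  by (auto simp: monomial_space_def in_keys_iff)

lemma monomial_space_sum:
  "(\<And>i. i \<in> A \<Longrightarrow> f i \<in> monomial_space N) \<Longrightarrow> sum f A \<in> monomial_space N"
  by (induction A rule: infinite_finite_induct) (auto intro: monomial_space_add)

lemma monomial_space_mult: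
  assumes "f \<in> monomial_space A" "g \<in> monomial_space B" "\<And>s t. s \<in> A \<Longrightarrow> t \<in> B \<Longrightarrow> s + t \<in> C"
  shows "f * g \<in> monomial_space C"
  using assms keys_mult[of f g] unfolding monomial_space_def by blast

lemma single_in_monomial_space [simp]:
  "Poly_Mapping.single t c \<in> monomial_space N \<longleftrightarrow> c = 0 \<or> t \<in> N"
  by (simp add: monomial_space_def)

lemma monomial_space_one: "1 \<in> monomial_space (exps p)"
  by (simp add: monomial_space_def)

lemma monomial_space_exps_mult:
  "f \<in> monomial_space (exps p) \<Longrightarrow> g \<in> monomial_space (exps p) \<Longrightarrow> f * g \<in> monomial_space (exps p)"
  by (erule monomial_space_mult) (auto simp: keys_expo_add)

lemma carrier_poly_ring: "carrier (poly_ring p) = monomial_space (exps p)"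
  by (simp add: poly_ring_def polys_in_eq)

lemma poly_ring_simps [simp]:
  "mult (poly_ring p) = (*)" "one (poly_ring p) = 1" "zero (poly_ring p) = 0" "add (poly_ring p) = (+)"
  by (simp_all add: poly_ring_def)

lemma cring_poly_ring: "cring (poly_ring p :: 'k::field mpoly ring)"
proof (rule cringI)
  show "abelian_group (poly_ring p :: 'k mpoly ring)"
    by (rule abelian_groupI)
      (auto simp: carrier_poly_ring monomial_space_add algebra_simps
        intro!: bexI[of _ "- _"] monomial_space_uminus)
  show "comm_monoid (poly_ring p :: 'k mpoly ring)"
    by (rule comm_monoidI)
      (auto simp: carrier_poly_ring algebra_simps monomial_space_one monomial_space_exps_mult simp del: One_nat_def)
qed (auto simp: algebra_simps)

section \<open>Stanley decompositions of quotients by monomial ideals\<close>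

locale monomial_ideal =
  fixes p :: nat and N :: "expo set"
  assumes N_sub: "N \<subseteq> exps p"
    and N_up: "t \<in> N \<Longrightarrow> s \<in> exps p \<Longrightarrow> s + t \<in> N"
begin

abbreviation M :: "('k::field mpoly, 'k mpoly set) module" where
  "M \<equiv> quot_module (poly_ring p) (monomial_space N)"

definition cl :: "'k::field mpoly \<Rightarrow> 'k mpoly set" where
  "cl f = monomial_space N +>\<^bsub>poly_ring p\<^esub> f"

lemma ideal_monomial_space: "ideal (monomial_space N :: 'k::field mpoly set) (poly_ring p)"
proof (rule idealI)
  interpret R: cring "poly_ring p :: 'k mpoly ring" by (rule cring_poly_ring)
  show "ring (poly_ring p :: 'k mpoly ring)" by (rule R.ring_axioms)
  show "subgroup (monomial_space N :: 'k mpoly set) (add_monoid (poly_ring p))"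
  proof (rule R.add.subgroupI)
    show "monomial_space N \<subseteq> carrier (poly_ring p :: 'k mpoly ring)"
      using N_sub by (auto simp: carrier_poly_ring monomial_space_def)
    show "monomial_space N \<noteq> ({} :: 'k mpoly set)"
      using monomial_space_zero by blast
    fix f :: "'k mpoly" assume f: "f \<in> monomial_space N"
    then have fc: "f \<in> carrier (poly_ring p)"
      using N_sub by (auto simp: carrier_poly_ring monomial_space_def)
    have "\<ominus>\<^bsub>poly_ring p\<^esub> f = - f"
      by (rule R.minus_equality)
        (use fc in \<open>auto simp: carrier_poly_ring monomial_space_uminus\<close>)
    then show "\<ominus>\<^bsub>poly_ring p\<^esub> f \<in> monomial_space N"
      using f by (simp add: monomial_space_uminus)
  qed (simp add: monomial_space_add)
  fix f g :: "'k mpoly" assume "f \<in> monomial_space N" "g \<in> carrier (poly_ring p)"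
  then have "g * f \<in> monomial_space N"
    by (auto simp: carrier_poly_ring simp del: One_nat_def intro: N_up monomial_space_mult)
  then show "g \<otimes>\<^bsub>poly_ring p\<^esub> f \<in> monomial_space N" "f \<otimes>\<^bsub>poly_ring p\<^esub> g \<in> monomial_space N"
    by (simp_all add: mult.commute)
qed

lemma cl_eq_iff:
  assumes "f \<in> polys_in {1..p}" "g \<in> polys_in {1..p}"
  shows "cl f = cl g \<longleftrightarrow> (\<forall>t. t \<notin> N \<longrightarrow> Poly_Mapping.lookup f t = Poly_Mapping.lookup g t)"
proof -
  interpret R: cring "poly_ring p :: 'a mpoly ring" by (rule cring_poly_ring)
  have c: "f \<in> carrier (poly_ring p)" "g \<in> carrier (poly_ring p)"
    using assms by (simp_all add: poly_ring_def)
  have "\<ominus>\<^bsub>poly_ring p\<^esub> g = - g"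
    by (rule R.minus_equality)
      (use c in \<open>auto simp: carrier_poly_ring monomial_space_uminus\<close>)
  then have "f \<ominus>\<^bsub>poly_ring p\<^esub> g = f - g"
    by (simp add: a_minus_def)
  then have "cl f = cl g \<longleftrightarrow> f - g \<in> monomial_space N"
    unfolding cl_def using R.quotient_eq_iff_same_a_r_cos[OF ideal_monomial_space c] by auto
  also have "\<dots> \<longleftrightarrow> (\<forall>t. t \<notin> N \<longrightarrow> Poly_Mapping.lookup f t = Poly_Mapping.lookup g t)"
    by (auto simp: monomial_space_def in_keys_iff lookup_minus)
  finally show ?thesis .
qed

lemma carrier_M: "carrier M = cl ` polys_in {1..p}"
  by (auto simp: quot_module_def FactRing_def A_RCOSETS_def' cl_def carrier_poly_ring polys_in_eq)

lemma add_M: "f \<in> polys_in {1..p} \<Longrightarrow> g \<in> polys_in {1..p} \<Longrightarrow> cl f \<oplus>\<^bsub>M\<^esub> cl g = cl (f + g)"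
  using ring_hom_add[OF ideal.rcos_ring_hom[OF ideal_monomial_space], of f g]
  by (simp add: quot_module_def cl_def carrier_poly_ring polys_in_eq)

lemma smult_M: "f \<in> polys_in {1..p} \<Longrightarrow> g \<in> polys_in {1..p} \<Longrightarrow> f \<odot>\<^bsub>M\<^esub> cl g = cl (f * g)"
  using ring_hom_mult[OF ideal.rcos_ring_hom[OF ideal_monomial_space], of f g]
  by (simp add: quot_module_def cl_def carrier_poly_ring polys_in_eq)

lemma zero_M: "\<zero>\<^bsub>M\<^esub> = cl 0"
proof -
  interpret ideal "monomial_space N" "poly_ring p" by (rule ideal_monomial_space)
  show ?thesis
    using a_rcos_const[of 0, symmetric] by (simp add: quot_module_def FactRing_def cl_def)
qed

lemma abelian_monoid_M: "abelian_monoid M"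
  by (rule abelian_monoidI)
    (auto simp: carrier_M zero_M add_M polys_in_add polys_in_eq monomial_space_add add_ac)

lemma finsum_M:
  assumes "finite A" "\<And>i. i \<in> A \<Longrightarrow> F i \<in> polys_in {1..p}"
  shows "(\<Oplus>\<^bsub>M\<^esub>i\<in>A. cl (F i)) = cl (\<Sum>i\<in>A. F i)"
proof -
  interpret abelian_monoid M by (rule abelian_monoid_M)
  show ?thesis using assms
  proof (induction A rule: finite_induct)
    case (insert x A)
    have "sum F A \<in> polys_in {1..p}"
      using insert by (auto simp: polys_in_eq intro: monomial_space_sum)
    moreover have "finsum M (\<lambda>i. cl (F i)) (insert x A) = cl (F x) \<oplus>\<^bsub>M\<^esub> finsum M (\<lambda>i. cl (F i)) A"
      using insert by (intro finsum_insert) (auto simp: carrier_M)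
    ultimately show ?case
      using insert by (simp add: add_M)
  qed (simp add: zero_M)
qed

lemma cl_eq_zero_iff:
  "f \<in> polys_in {1..p} \<Longrightarrow> cl f = \<zero>\<^bsub>M\<^esub> \<longleftrightarrow> f \<in> monomial_space N"
  by (subst zero_M, subst cl_eq_iff) (auto simp: polys_in_eq monomial_space_def in_keys_iff)

lemma stanley_space_monomial:
  fixes c :: "'k::field"
  assumes "Poly_Mapping.keys b \<subseteq> {1..p}" "Z \<subseteq> {1..p}" "c \<noteq> 0"
  shows "stanley_space M (cl (Poly_Mapping.single b c)) Z = cl ` monomial_space (cone b Z)"
proof -
  have sub: "polys_in Z \<subseteq> polys_in {1..p}" using assms by (auto simp: polys_in_def)
  have b: "Poly_Mapping.single b c \<in> polys_in {1..p}" using assms by (simp add: polys_in_eq)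
  have "(\<lambda>u. u * Poly_Mapping.single b c) ` polys_in Z = monomial_space (cone b Z)"
  proof (intro equalityI subsetI)
    fix f :: "'k mpoly" assume "f \<in> (\<lambda>u. u * Poly_Mapping.single b c) ` polys_in Z"
    then show "f \<in> monomial_space (cone b Z)"
      by (auto simp: polys_in_eq cone_def add.commute intro!: monomial_space_mult[where B = "{b}"])
  next
    fix f :: "'k mpoly" assume f: "f \<in> monomial_space (cone b Z)"
    define u where "u = (\<Sum>t \<in> Poly_Mapping.keys f. Poly_Mapping.single (t - b) (Poly_Mapping.lookup f t / c))"
    have k: "t - b + b = t" "Poly_Mapping.keys (t - b) \<subseteq> Z" if "t \<in> Poly_Mapping.keys f" for t
    proof -
      obtain v where "t = b + v" "Poly_Mapping.keys v \<subseteq> Z"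
        using f \<open>t \<in> Poly_Mapping.keys f\<close> by (auto simp: monomial_space_def cone_def)
      then show "t - b + b = t" "Poly_Mapping.keys (t - b) \<subseteq> Z"
        by (simp_all add: add.commute)
    qed
    have "u \<in> polys_in Z"
      unfolding u_def polys_in_eq using k(2) by (intro monomial_space_sum) auto
    moreover have "u * Poly_Mapping.single b c = f"
      unfolding u_def sum_distrib_right mult_single
      using k(1) assms(3) by (subst (2) sum_monomials[symmetric]) (auto intro!: sum.cong)
    ultimately show "f \<in> (\<lambda>u. u * Poly_Mapping.single b c) ` polys_in Z" by blast
  qed
  moreover have "stanley_space M (cl (Poly_Mapping.single b c)) Z
      = cl ` (\<lambda>u. u * Poly_Mapping.single b c) ` polys_in Z"
    unfolding stanley_space_def image_image using sub b by (intro image_cong) (auto simp: smult_M)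
  ultimately show ?thesis by simp
qed

lemma homogeneous_cases:
  assumes "x \<in> quot_grading p (monomial_space N) a" "x \<noteq> \<zero>\<^bsub>M\<^esub>"
  obtains b c where "x = cl (Poly_Mapping.single b c)" "c \<noteq> 0" "b \<in> exps p"
proof -
  obtain f where f: "f \<in> poly_grading p a" "x = cl f"
    using assms(1) by (auto simp: quot_grading_def cl_def)
  have "f \<noteq> 0" using assms(2) f(2) zero_M by blast
  then obtain b where b: "b \<in> Poly_Mapping.keys f" by fastforce
  have "t = b" if "t \<in> Poly_Mapping.keys f" for t
    using f(1) b that by (intro poly_mapping_eqI) (metis (mono_tags, lifting) mem_Collect_eq of_nat_eq_iff poly_grading_def)
  then have "Poly_Mapping.keys f = {b}" using b by blast
  then have "f = Poly_Mapping.single b (Poly_Mapping.lookup f b)"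
    using sum_monomials[of f] by simp
  moreover have "b \<in> exps p" using f(1) b by (auto simp: poly_grading_def polys_in_def)
  ultimately show ?thesis using that f(2) b by (metis in_keys_iff)
qed

lemma cone_partition_of_stanley_decomposition:
  assumes "stanley_decomposition p (M :: ('k::field mpoly, 'k mpoly set) module) (quot_grading p (monomial_space N)) D"
  obtains C where "cone_partition (exps p - N) C" "map snd C = map snd D"
proof -
  let ?Z = "\<lambda>i. snd (D ! i)"
  have D: "fst (D ! i) \<in> carrier M" "\<exists>a. fst (D ! i) \<in> quot_grading p (monomial_space N) a" "?Z i \<subseteq> {1..p}"
    "\<And>u. u \<in> polys_in (?Z i) \<Longrightarrow> u \<odot>\<^bsub>M\<^esub> fst (D ! i) = \<zero>\<^bsub>M\<^esub> \<Longrightarrow> u = 0" if "i < length D" for i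
    using assms nth_mem[OF that] unfolding stanley_decomposition_def by (fastforce split: prod.splits)+
  have "\<exists>b c. fst (D ! i) = cl (Poly_Mapping.single b c) \<and> c \<noteq> 0 \<and> b \<in> exps p" if i: "i < length D" for i
  proof -
    obtain f where f: "f \<in> polys_in {1..p}" "fst (D ! i) = cl f"
      using D(1)[OF i] by (auto simp: carrier_M)
    have 1: "1 \<in> polys_in W" for W by (simp add: polys_in_def)
    have "fst (D ! i) \<noteq> \<zero>\<^bsub>M\<^esub>"
      using D(4)[OF i, of 1] 1 smult_M[of 1 f] f by auto
    then show ?thesis using D(2)[OF i] homogeneous_cases by metis
  qed
  then obtain b c where bc: "fst (D ! i) = cl (Poly_Mapping.single (b i) (c i))" "c i \<noteq> 0" "b i \<in> exps p"
    if "i < length D" for i by metis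
  define W where "W i = cone (b i) (?Z i)" for i
  have St: "stanley_space M (fst (D ! i)) (?Z i) = cl ` monomial_space (W i)" if "i < length D" for i
    using bc[OF that] D(3)[OF that] stanley_space_monomial by (simp add: W_def)
  have WP: "W i \<subseteq> exps p - N" if i: "i < length D" for i
  proof
    fix t assume "t \<in> W i"
    then obtain v where v: "t = b i + v" "Poly_Mapping.keys v \<subseteq> ?Z i" by (auto simp: W_def cone_def)
    have te: "t \<in> exps p" using v bc(3)[OF i] D(3)[OF i] by (auto simp: keys_expo_add)
    have u: "Poly_Mapping.single v 1 \<in> polys_in (?Z i)" using v by (simp add: polys_in_eq)
    then have "Poly_Mapping.single v 1 \<odot>\<^bsub>M\<^esub> fst (D ! i) \<noteq> \<zero>\<^bsub>M\<^esub>"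
      using D(4)[OF i u] by (metis lookup_single_eq lookup_zero zero_neq_one)
    moreover have "Poly_Mapping.single v 1 \<odot>\<^bsub>M\<^esub> fst (D ! i) = cl (Poly_Mapping.single t (c i))"
      using v bc[OF i] D(3)[OF i]
      by (simp only: bc(1)[OF i], subst smult_M) (auto simp: polys_in_eq mult_single add.commute)
    ultimately have "t \<notin> N"
      using te cl_eq_zero_iff[of "Poly_Mapping.single t (c i)"] by (auto simp: polys_in_eq)
    then show "t \<in> exps p - N" using te by blast
  qed
  have dec: "\<exists>!f. f \<in> (\<Pi>\<^sub>E i\<in>{..<length D}. stanley_space M (fst (D ! i)) (?Z i)) \<and>
      x = (\<Oplus>\<^bsub>M\<^esub>i\<in>{..<length D}. f i)" if "x \<in> carrier M" for x
    by (rule bspec[OF conjunct2[OF assms[unfolded stanley_decomposition_def]] that])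
  have ex: "\<exists>i<length D. t \<in> W i" if t: "t \<in> exps p - N" for t
  proof -
    have tc: "Poly_Mapping.single t 1 \<in> polys_in {1..p}" using t by (simp add: polys_in_eq)
    then obtain f where f: "f \<in> (\<Pi>\<^sub>E i\<in>{..<length D}. stanley_space M (fst (D ! i)) (?Z i))"
       "cl (Poly_Mapping.single t (1::'k)) = (\<Oplus>\<^bsub>M\<^esub>i\<in>{..<length D}. f i)"
      using ex1_implies_ex[OF dec[unfolded carrier_M, OF imageI[OF tc]]] by blast
    have "\<exists>F. F \<in> monomial_space (W i) \<and> f i = cl F" if "i < length D" for i
      using PiE_mem[OF f(1), of i] St[OF that] that by auto
    then obtain F where F: "F i \<in> monomial_space (W i)" "f i = cl (F i)" if "i < length D" for i
      by metis
    have Fp: "F i \<in> polys_in {1..p}" if "i < length D" for i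
      using F(1)[OF that] WP[OF that] by (auto simp: polys_in_eq monomial_space_def)
    interpret abelian_monoid M by (rule abelian_monoid_M)
    have "(\<Oplus>\<^bsub>M\<^esub>i\<in>{..<length D}. f i) = (\<Oplus>\<^bsub>M\<^esub>i\<in>{..<length D}. cl (F i))"
      using F Fp by (intro finsum_cong') (auto simp: carrier_M)
    also have "\<dots> = cl (\<Sum>i<length D. F i)" using Fp by (intro finsum_M) auto
    finally have "cl (Poly_Mapping.single t (1::'k)) = cl (\<Sum>i<length D. F i)" using f(2) by simp
    then have "Poly_Mapping.lookup (\<Sum>i<length D. F i) t = 1"
      using t tc Fp by (subst (asm) cl_eq_iff) (auto simp: polys_in_eq lookup_single when_def intro: monomial_space_sum)
    then have "\<exists>i<length D. Poly_Mapping.lookup (F i) t \<noteq> 0"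
      unfolding lookup_sum by (metis lessThan_iff sum.neutral zero_neq_one)
    then show ?thesis using F(1) unfolding monomial_space_def mem_Collect_eq in_keys_iff[symmetric] by blast
  qed
  have uniq: "i = j" if ij: "i < length D" "j < length D" "t \<in> W i" "t \<in> W j" for i j t
  proof (rule ccontr)
    assume "i \<noteq> j"
    have t: "t \<in> exps p - N" using ij WP by blast
    define s where "s = Poly_Mapping.single t (1::'k)"
    have s: "s \<in> polys_in {1..p}" using t by (simp add: polys_in_eq s_def)
    define F where "F k = (\<lambda>l\<in>{..<length D}. cl (if l = k then s else 0))" for k
    have P: "F k \<in> (\<Pi>\<^sub>E i\<in>{..<length D}. stanley_space M (fst (D ! i)) (?Z i)) \<and>
      cl s = (\<Oplus>\<^bsub>M\<^esub>i\<in>{..<length D}. F k i)" if k: "k < length D" "t \<in> W k" for k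
    proof
      show "F k \<in> (\<Pi>\<^sub>E i\<in>{..<length D}. stanley_space M (fst (D ! i)) (?Z i))"
        using k by (auto simp: F_def St s_def)
      interpret abelian_monoid M by (rule abelian_monoid_M)
      have "(\<Oplus>\<^bsub>M\<^esub>i\<in>{..<length D}. F k i) = (\<Oplus>\<^bsub>M\<^esub>i\<in>{..<length D}. cl (if i = k then s else 0))"
        using s by (intro finsum_cong') (auto simp: F_def carrier_M polys_in_eq)
      also have "\<dots> = cl (\<Sum>i<length D. if i = k then s else 0)"
        using s by (intro finsum_M) (auto simp: polys_in_eq)
      also have "\<dots> = cl s" using k by simp
      finally show "cl s = (\<Oplus>\<^bsub>M\<^esub>i\<in>{..<length D}. F k i)" by simp
    qed
    have "F i = F j" using dec[unfolded carrier_M, OF imageI[OF s]] P[OF ij(1,3)] P[OF ij(2,4)] by blast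
    then have "F i i = F j i" by simp
    then have "cl s = cl 0" using ij \<open>i \<noteq> j\<close> by (simp add: F_def)
    then show False
      using t s by (subst (asm) cl_eq_iff) (auto simp: polys_in_eq s_def dest: spec[of _ t])
  qed
  define C where "C = map (\<lambda>i. (b i, ?Z i)) [0..<length D]"
  have "map snd C = map snd D" by (auto simp: C_def intro: nth_equalityI)
  moreover have "cone_partition (exps p - N) C"
    using WP ex uniq unfolding cone_partition_def
    by (fastforce simp: C_def W_def)
  ultimately show ?thesis using that by blast
qed

lemma cone_partition_memD:
  assumes "cone_partition (exps p - N) C" "(b, Z) \<in> set C"
  shows "b \<in> exps p" "Z \<subseteq> {1..p}" "cone b Z \<subseteq> exps p - N"
proof -
  show sub: "cone b Z \<subseteq> exps p - N" using cone_partition_subset assms .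
  have "b + 0 \<in> cone b Z" unfolding cone_def by force
  then show "b \<in> exps p" using sub by auto
  show "Z \<subseteq> {1..p}"
  proof
    fix z assume "z \<in> Z"
    then have "b + Poly_Mapping.single z 1 \<in> cone b Z" unfolding cone_def by force
    then show "z \<in> {1..p}" using sub by (auto simp: keys_expo_add)
  qed
qed

lemma stanley_decomposition_of_cone_partition:
  assumes C: "cone_partition (exps p - N) C"
  shows "stanley_decomposition p (M :: ('k::field mpoly, 'k mpoly set) module) (quot_grading p (monomial_space N))
    (map (\<lambda>(b, Z). (cl (Poly_Mapping.single b 1), Z)) C)" (is "stanley_decomposition p _ _ ?D")
  unfolding stanley_decomposition_def
proof (rule conjI; rule ballI)
  fix mZ assume "mZ \<in> set ?D"
  then obtain b Z where bZ: "(b, Z) \<in> set C" "mZ = (cl (Poly_Mapping.single b (1::'k)), Z)" by auto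
  note c = cone_partition_memD[OF C bZ(1)]
  have b: "Poly_Mapping.single b (1::'k) \<in> polys_in {1..p}" using c by (simp add: polys_in_eq)
  have "cl (Poly_Mapping.single b (1::'k)) \<in> quot_grading p (monomial_space N) (\<lambda>i. int (Poly_Mapping.lookup b i))"
    using b by (auto simp: quot_grading_def cl_def poly_grading_def)
  moreover have "(\<lambda>i. int (Poly_Mapping.lookup b i)) \<in> zdegs p"
    using c(1) by (auto simp: zdegs_def in_keys_iff)
  moreover have "cl (Poly_Mapping.single b (1::'k)) \<in> carrier M"
    unfolding carrier_M using b by (rule imageI)
  moreover have "u = 0" if u: "u \<in> polys_in Z" "u \<odot>\<^bsub>M\<^esub> cl (Poly_Mapping.single b 1) = \<zero>\<^bsub>M\<^esub>" for u :: "'k mpoly"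
  proof -
    let ?g = "u * Poly_Mapping.single b 1"
    have up: "u \<in> polys_in {1..p}" using u(1) c(2) by (auto simp: polys_in_def)
    have g: "?g \<in> monomial_space (cone b Z)"
      using u(1) by (auto simp: polys_in_eq cone_def add.commute intro!: monomial_space_mult[where B = "{b}"])
    then have "?g \<in> polys_in {1..p}"
      using c(3) by (auto simp: polys_in_eq monomial_space_def)
    then have "?g \<in> monomial_space N"
      using u(2) by (simp add: smult_M[OF up b] cl_eq_zero_iff)
    then have "Poly_Mapping.keys ?g = {}" using g c(3) unfolding monomial_space_def by blast
    then have "?g = 0" by (simp add: poly_mapping_eq_iff fun_eq_iff in_keys_iff)
    moreover have "Poly_Mapping.single b (1::'k) \<noteq> 0"
      by (metis lookup_single_eq lookup_zero zero_neq_one)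
    ultimately show "u = 0" by simp
  qed
  ultimately show "case mZ of (m, Z) \<Rightarrow> m \<in> carrier M \<and> (\<exists>a\<in>zdegs p. m \<in> quot_grading p (monomial_space N) a)
     \<and> Z \<subseteq> {1..p} \<and> (\<forall>u\<in>polys_in Z. u \<odot>\<^bsub>M\<^esub> m = \<zero>\<^bsub>M\<^esub> \<longrightarrow> u = 0)"
    using bZ c(2) by blast
next
  fix x :: "'k mpoly set" assume "x \<in> carrier M"
  then obtain g where g: "g \<in> polys_in {1..p}" "x = cl g" by (auto simp: carrier_M)
  define W where "W i = cone (fst (C ! i)) (snd (C ! i))" for i
  let ?L = "{..<length C}"
  have len: "length ?D = length C" by simp
  have WP: "W i \<subseteq> exps p - N" if "i < length C" for i
    using cone_partition_memD(3)[OF C, of "fst (C ! i)" "snd (C ! i)"] that by (simp add: W_def)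
  have part: "\<exists>!i. i < length C \<and> t \<in> W i" if "t \<in> exps p - N" for t
    using C that by (simp add: cone_partition_def W_def)
  have St: "stanley_space M (fst (?D ! i)) (snd (?D ! i)) = cl ` monomial_space (W i)" if "i < length C" for i
    using stanley_space_monomial[of "fst (C ! i)" "snd (C ! i)" "1::'k"]
      cone_partition_memD[OF C, of "fst (C ! i)" "snd (C ! i)"] that
    by (simp add: W_def case_prod_beta)
  have PE: "(\<Pi>\<^sub>E i\<in>?L. stanley_space M (fst (?D ! i)) (snd (?D ! i))) = (\<Pi>\<^sub>E i\<in>?L. cl ` monomial_space (W i))"
    using St by (intro PiE_cong) auto
  have pin: "h \<in> polys_in {1..p}" if "h \<in> monomial_space (W i)" "i < length C" for h :: "'k mpoly" and i
    using that WP[OF that(2)] by (auto simp: polys_in_eq monomial_space_def)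
  interpret abelian_monoid M by (rule abelian_monoid_M)
  have sumW: "Poly_Mapping.lookup (\<Sum>j<length C. F j) t = Poly_Mapping.lookup (F i) t"
    if "\<And>j. j < length C \<Longrightarrow> F j \<in> monomial_space (W j)" "i < length C" "t \<in> W i" for F :: "nat \<Rightarrow> 'k mpoly" and i t
  proof -
    have "Poly_Mapping.lookup (F j) t = 0" if "j \<in> ?L - {i}" for j
    proof -
      have "t \<notin> W j" using that part[of t] WP[of i] \<open>i < length C\<close> \<open>t \<in> W i\<close> by blast
      then show ?thesis using \<open>j < length C \<Longrightarrow> F j \<in> monomial_space (W j)\<close> that
        by (auto simp: monomial_space_def in_keys_iff)
    qed
    then show ?thesis using that(2) unfolding lookup_sum by (subst sum.remove[of ?L i]) simp_all
  qed
  show "\<exists>!f. f \<in> (\<Pi>\<^sub>E i\<in>{..<length ?D}. stanley_space M (fst (?D ! i)) (snd (?D ! i))) \<and>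
      x = (\<Oplus>\<^bsub>M\<^esub>i\<in>{..<length ?D}. f i)"
    unfolding len PE
  proof (rule ex_ex1I)
    define F where "F i = restrict_keys (W i) g" for i
    have F: "F i \<in> monomial_space (W i)" for i
      by (auto simp: F_def monomial_space_def in_keys_iff lookup_restrict_keys split: if_splits)
    have "(\<Oplus>\<^bsub>M\<^esub>i\<in>?L. (\<lambda>i\<in>?L. cl (F i)) i) = (\<Oplus>\<^bsub>M\<^esub>i\<in>?L. cl (F i))"
      using pin[OF F] by (intro finsum_cong') (auto simp: carrier_M)
    also have "\<dots> = cl (\<Sum>i<length C. F i)" using pin[OF F] by (intro finsum_M) auto
    also have "\<dots> = cl g"
    proof (subst cl_eq_iff)
      show "(\<Sum>i<length C. F i) \<in> polys_in {1..p}"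
        using pin[OF F] by (auto simp: polys_in_eq intro: monomial_space_sum)
      show "\<forall>t. t \<notin> N \<longrightarrow> Poly_Mapping.lookup (\<Sum>i<length C. F i) t = Poly_Mapping.lookup g t"
      proof (intro allI impI)
        fix t assume t: "t \<notin> N"
        show "Poly_Mapping.lookup (\<Sum>i<length C. F i) t = Poly_Mapping.lookup g t"
        proof (cases "t \<in> exps p")
          case True
          then obtain i where "i < length C" "t \<in> W i" using part[of t] t by blast
          then show ?thesis using sumW[of F i t] F by (simp add: F_def lookup_restrict_keys)
        next
          case False
          then have "Poly_Mapping.lookup g t = 0"
            using g(1) by (auto simp: polys_in_def in_keys_iff)
          then show ?thesis by (simp add: lookup_sum F_def lookup_restrict_keys cong: if_cong)
        qed
      qed
    qed (rule g(1))
    finally have "x = (\<Oplus>\<^bsub>M\<^esub>i\<in>?L. (\<lambda>i\<in>?L. cl (F i)) i)" using g(2) by simp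
    moreover have "(\<lambda>i\<in>?L. cl (F i)) \<in> (\<Pi>\<^sub>E i\<in>?L. cl ` monomial_space (W i))" using F by auto
    ultimately show "\<exists>f. f \<in> (\<Pi>\<^sub>E i\<in>?L. cl ` monomial_space (W i)) \<and> x = (\<Oplus>\<^bsub>M\<^esub>i\<in>?L. f i)" by blast
  next
    have rep: "\<exists>F. (\<forall>i\<in>?L. F i \<in> monomial_space (W i) \<and> f i = cl (F i)) \<and> x = cl (\<Sum>i<length C. F i)
        \<and> (\<Sum>i<length C. F i) \<in> polys_in {1..p}"
      if f: "f \<in> (\<Pi>\<^sub>E i\<in>?L. cl ` monomial_space (W i)) \<and> x = (\<Oplus>\<^bsub>M\<^esub>i\<in>?L. f i)" for f
    proof -
      have "\<forall>i\<in>?L. \<exists>h. h \<in> monomial_space (W i) \<and> f i = cl h" using f by (auto simp: PiE_iff)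
      then obtain F where F: "\<And>i. i \<in> ?L \<Longrightarrow> F i \<in> monomial_space (W i) \<and> f i = cl (F i)" by metis
      have Fp: "F i \<in> polys_in {1..p}" if "i \<in> ?L" for i using F pin that by blast
      have "x = (\<Oplus>\<^bsub>M\<^esub>i\<in>?L. cl (F i))"
        unfolding conjunct2[OF f] using F Fp by (intro finsum_cong') (auto simp: carrier_M)
      also have "\<dots> = cl (\<Sum>i<length C. F i)" using Fp by (intro finsum_M) auto
      finally show ?thesis
        using F Fp by (intro exI[of _ F]) (auto simp only: polys_in_eq intro: monomial_space_sum)
    qed
    fix f f' assume f: "f \<in> (\<Pi>\<^sub>E i\<in>?L. cl ` monomial_space (W i)) \<and> x = (\<Oplus>\<^bsub>M\<^esub>i\<in>?L. f i)"
      and f': "f' \<in> (\<Pi>\<^sub>E i\<in>?L. cl ` monomial_space (W i)) \<and> x = (\<Oplus>\<^bsub>M\<^esub>i\<in>?L. f' i)"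
    obtain F where F: "\<And>i. i \<in> ?L \<Longrightarrow> F i \<in> monomial_space (W i)" "\<And>i. i \<in> ?L \<Longrightarrow> f i = cl (F i)"
      "x = cl (\<Sum>i<length C. F i)" "(\<Sum>i<length C. F i) \<in> polys_in {1..p}"
      using rep[OF f] by blast
    obtain F' where F': "\<And>i. i \<in> ?L \<Longrightarrow> F' i \<in> monomial_space (W i)" "\<And>i. i \<in> ?L \<Longrightarrow> f' i = cl (F' i)"
      "x = cl (\<Sum>i<length C. F' i)" "(\<Sum>i<length C. F' i) \<in> polys_in {1..p}"
      using rep[OF f'] by blast
    have FF': "F i = F' i" if i: "i \<in> ?L" for i
    proof (rule poly_mapping_eqI)
      fix t
      show "Poly_Mapping.lookup (F i) t = Poly_Mapping.lookup (F' i) t"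
      proof (cases "t \<in> W i")
        case True
        then have "t \<notin> N" using WP i by auto
        then have "Poly_Mapping.lookup (\<Sum>i<length C. F i) t = Poly_Mapping.lookup (\<Sum>i<length C. F' i) t"
          using F(3,4) F'(3,4) cl_eq_iff by metis
        then show ?thesis using sumW[of F i t] sumW[of F' i t] F(1) F'(1) i True by simp
      next
        case False
        then have "t \<notin> Poly_Mapping.keys (F i)" "t \<notin> Poly_Mapping.keys (F' i)"
          using F(1)[OF i] F'(1)[OF i] by (auto simp: monomial_space_def)
        then show ?thesis by (simp add: in_keys_iff)
      qed
    qed
    show "f = f'"
      by (rule PiE_ext[OF conjunct1[OF f] conjunct1[OF f']]) (simp add: F(2) F'(2) FF')
  qed
qed

end

section \<open>Squarefree exponents and Hilbert depth\<close>

lemma alternating_binomial_nonneg: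
  fixes c d k :: nat
  assumes "k \<le> d" "d \<le> c"
  shows "0 \<le> (\<Sum>j=0..k. (-1) ^ (k - j) * int ((d - j) choose (k - j)) * int (c choose j))"
  using assms
proof (induction c arbitrary: d k)
  case 0
  then show ?case by simp
next
  case (Suc c)
  show ?case
  proof (cases "d = Suc c")
    case True
    have "(-1) ^ (k - j) * int ((d - j) choose (k - j)) * int (d choose j)
        = int (d choose k) * (int (k choose j) * 1 ^ j * (-1) ^ (k - j))" if "j \<in> {..k}" for j
    proof -
      have "(d choose k) * (k choose j) = (d choose j) * ((d - j) choose (k - j))"
        using Suc.prems that by (intro choose_mult) auto
      then have "int (d choose k) * int (k choose j) = int (d choose j) * int ((d - j) choose (k - j))"
        by (metis of_nat_mult)
      then show ?thesis by (simp add: algebra_simps)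
    qed
    then have "(\<Sum>j\<le>k. (-1) ^ (k - j) * int ((d - j) choose (k - j)) * int (d choose j))
        = int (d choose k) * (1 + (- 1)) ^ k"
      unfolding binomial_ring sum_distrib_left by (intro sum.cong) simp_all
    also have "\<dots> \<ge> 0" by (cases k) auto
    finally show ?thesis using True by (simp add: atLeast0AtMost)
  next
    case False
    then have d: "d \<le> c" using Suc.prems by simp
    show ?thesis
    proof (cases k)
      case (Suc k')
      obtain d' where d': "d = Suc d'" using Suc Suc.prems by (cases d) auto
      have split: "int (Suc c choose Suc j) = int (c choose Suc j) + int (c choose j)" for j by simp
      have "(\<Sum>j=0..k. (-1) ^ (k - j) * int ((d - j) choose (k - j)) * int (Suc c choose j))
         = (\<Sum>j=0..k. (-1) ^ (k - j) * int ((d - j) choose (k - j)) * int (c choose j))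
         + (\<Sum>j=0..k'. (-1) ^ (k' - j) * int ((d' - j) choose (k' - j)) * int (c choose j))"
        unfolding Suc d' sum.atLeast0_atMost_Suc_shift
        by (simp add: algebra_simps sum.distrib del: sum.cl_ivl_Suc)
      also have "\<dots> \<ge> 0"
        using Suc.IH[of k d] Suc.IH[of k' d'] Suc.prems d Suc d' by simp
      finally show ?thesis .
    qed simp
  qed
qed

lemma shifted_alternating_binomial_nonneg:
  fixes c d k s :: nat
  assumes "k \<le> d" "d \<le> s + c"
  shows "0 \<le> (\<Sum>j=0..k. (-1) ^ (k - j) * int ((d - j) choose (k - j)) * (if s \<le> j then int (c choose (j - s)) else 0))"
proof (cases "s \<le> k")
  case True
  have "(\<Sum>j=0..k. (-1) ^ (k - j) * int ((d - j) choose (k - j)) * (if s \<le> j then int (c choose (j - s)) else 0))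
    = (\<Sum>j=s..k. (-1) ^ (k - j) * int ((d - j) choose (k - j)) * int (c choose (j - s)))"
    by (rule sum.mono_neutral_cong_right) auto
  also have "\<dots> = (\<Sum>j=0..k-s. (-1) ^ (k - s - j) * int ((d - s - j) choose (k - s - j)) * int (c choose j))"
    by (rule sum.reindex_bij_witness[of _ "\<lambda>j. j + s" "\<lambda>j. j - s"]) (use True in \<open>auto simp: algebra_simps\<close>)
  also have "\<dots> \<ge> 0" using assms by (intro alternating_binomial_nonneg) auto
  finally show ?thesis .
qed (auto intro!: sum_nonneg)

definition sqfree_expo :: "expo \<Rightarrow> bool" where
  "sqfree_expo t \<longleftrightarrow> (\<forall>i. Poly_Mapping.lookup t i \<le> 1)"

lemma sqfree_expo_eqI:
  assumes "sqfree_expo s" "sqfree_expo t" "Poly_Mapping.keys s = Poly_Mapping.keys t"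
  shows "s = t"
proof (rule poly_mapping_eqI)
  fix i
  have "Poly_Mapping.lookup s i \<le> 1" "Poly_Mapping.lookup t i \<le> 1"
    using assms by (auto simp: sqfree_expo_def)
  moreover have "Poly_Mapping.lookup s i = 0 \<longleftrightarrow> Poly_Mapping.lookup t i = 0"
    using assms(3) by (metis in_keys_iff)
  ultimately show "Poly_Mapping.lookup s i = Poly_Mapping.lookup t i" by linarith
qed

lemma sqfree_expo_exists:
  assumes "finite V"
  obtains t where "sqfree_expo t" "Poly_Mapping.keys t = V"
proof
  let ?t = "\<Sum>i\<in>V. Poly_Mapping.single i 1 :: expo"
  have "Poly_Mapping.lookup ?t i = (if i \<in> V then 1 else 0)" for i
    using assms by (simp add: lookup_sum lookup_single when_def)
  then show "sqfree_expo ?t" "Poly_Mapping.keys ?t = V"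
    by (auto simp: sqfree_expo_def in_keys_iff simp del: neq0_conv One_nat_def split: if_splits)
qed

lemma sqfree_count_eq:
  "sqfree_count p (monomial_space N :: 'k::field mpoly set) (carrier (poly_ring p)) j
     = card {t \<in> exps p - N. sqfree_expo t \<and> card (Poly_Mapping.keys t) = j}"
proof -
  have "(\<Sum>i\<in>Poly_Mapping.keys t. Poly_Mapping.lookup t i) = card (Poly_Mapping.keys t)"
    if "sqfree_expo t" for t
  proof -
    have "Poly_Mapping.lookup t i = 1" if "i \<in> Poly_Mapping.keys t" for i
      using that \<open>sqfree_expo t\<close> unfolding sqfree_expo_def in_keys_iff
      by (metis One_nat_def le_Suc_eq le_zero_eq)
    then show ?thesis by simp
  qed
  then show ?thesis
    unfolding sqfree_count_def
    by (intro arg_cong[where f = card]) (auto simp: carrier_poly_ring sqfree_expo_def)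
qed

lemma finite_sqfree_expos: "finite {t \<in> exps p. sqfree_expo t}"
proof (rule finite_imageD)
  show "finite (Poly_Mapping.keys ` {t \<in> exps p. sqfree_expo t})"
    by (rule finite_subset[of _ "Pow {1..p}"]) auto
  show "inj_on Poly_Mapping.keys {t \<in> exps p. sqfree_expo t}"
    by (auto intro: inj_onI sqfree_expo_eqI)
qed

lemma card_sqfree_cone:
  assumes "finite Z"
  shows "card {t \<in> cone b Z. sqfree_expo t \<and> card (Poly_Mapping.keys t) = j} =
    (if sqfree_expo b \<and> card (Poly_Mapping.keys b) \<le> j
     then card (Z - Poly_Mapping.keys b) choose (j - card (Poly_Mapping.keys b)) else 0)"
proof (cases "sqfree_expo b \<and> card (Poly_Mapping.keys b) \<le> j")
  case True
  let ?B = "Poly_Mapping.keys b"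
  let ?T = "{t \<in> cone b Z. sqfree_expo t \<and> card (Poly_Mapping.keys t) = j}"
  have "bij_betw (\<lambda>t. Poly_Mapping.keys t - ?B) ?T {V. V \<subseteq> Z - ?B \<and> card V = j - card ?B}"
  proof (rule bij_betw_imageI)
    have sub: "?B \<subseteq> Poly_Mapping.keys t" if "t \<in> cone b Z" for t
      using that by (auto simp: cone_def keys_expo_add)
    then show "inj_on (\<lambda>t. Poly_Mapping.keys t - ?B) ?T"
      by (intro inj_onI sqfree_expo_eqI) blast+
    show "(\<lambda>t. Poly_Mapping.keys t - ?B) ` ?T = {V. V \<subseteq> Z - ?B \<and> card V = j - card ?B}"
    proof (intro equalityI subsetI)
      fix V assume "V \<in> (\<lambda>t. Poly_Mapping.keys t - ?B) ` ?T"
      then obtain t where t: "t \<in> ?T" "V = Poly_Mapping.keys t - ?B" by blast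
      have "V \<subseteq> Z - ?B" using t by (auto simp: cone_def keys_expo_add)
      moreover have "card V = j - card ?B" using t sub by (simp add: card_Diff_subset)
      ultimately show "V \<in> {V. V \<subseteq> Z - ?B \<and> card V = j - card ?B}" by simp
    next
      fix V assume V: "V \<in> {V. V \<subseteq> Z - ?B \<and> card V = j - card ?B}"
      then have fV: "finite V" using assms finite_subset by auto
      then obtain v where v: "sqfree_expo v" "Poly_Mapping.keys v = V" by (rule sqfree_expo_exists)
      have "Poly_Mapping.lookup b i = 0 \<or> Poly_Mapping.lookup v i = 0" for i
        using v(2) V by (auto simp flip: not_in_keys_iff_lookup_eq_zero)
      then have "sqfree_expo (b + v)"
        using v(1) True unfolding sqfree_expo_def lookup_add by (metis add_0 add_0_right)
      moreover have "card (?B \<union> V) = j" using V fV True by (subst card_Un_disjoint) auto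
      ultimately have "b + v \<in> ?T" using v(2) V by (auto simp: cone_def keys_expo_add)
      moreover have "V = Poly_Mapping.keys (b + v) - ?B" using v(2) V by (auto simp: keys_expo_add)
      ultimately show "V \<in> (\<lambda>t. Poly_Mapping.keys t - ?B) ` ?T" by blast
    qed
  qed
  then have "card ?T = card (Z - ?B) choose (j - card ?B)"
    using assms by (simp add: bij_betw_same_card n_subsets)
  then show ?thesis using True by simp
next
  case False
  have "sqfree_expo b \<and> card (Poly_Mapping.keys b) \<le> card (Poly_Mapping.keys t)"
    if t: "t \<in> cone b Z" "sqfree_expo t" for t
  proof -
    obtain v where "t = b + v" using t by (auto simp: cone_def)
    then have "sqfree_expo b" "Poly_Mapping.keys b \<subseteq> Poly_Mapping.keys t"
      using t(2) by (auto simp: sqfree_expo_def lookup_add keys_expo_add intro: add_leD1)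
    then show ?thesis by (simp add: card_mono)
  qed
  then have "{t \<in> cone b Z. sqfree_expo t \<and> card (Poly_Mapping.keys t) = j} = {}"
    using False by auto
  then show ?thesis using False by (simp only: card.empty if_False)
qed

lemma hbeta_cone_partition_nonneg:
  fixes N :: "expo set"
  assumes C: "cone_partition (exps p - N) C"
    and Z: "\<And>b Z. (b, Z) \<in> set C \<Longrightarrow> finite Z \<and> d \<le> card Z"
    and k: "k \<le> d"
  shows "0 \<le> hbeta p (monomial_space N :: 'k::field mpoly set) (carrier (poly_ring p)) d k"
proof -
  define b where "b i = fst (C ! i)" for i
  define z where "z i = snd (C ! i)" for i
  have bz: "(b i, z i) \<in> set C" if "i < length C" for i using that by (simp add: b_def z_def)
  have fin: "finite (z i)" "d \<le> card (z i)" if "i < length C" for i using Z[OF bz[OF that]] by auto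
  let ?T = "\<lambda>i j. {t \<in> cone (b i) (z i). sqfree_expo t \<and> card (Poly_Mapping.keys t) = j}"
  let ?w = "\<lambda>i j. if sqfree_expo (b i) \<and> card (Poly_Mapping.keys (b i)) \<le> j
     then int (card (z i - Poly_Mapping.keys (b i)) choose (j - card (Poly_Mapping.keys (b i)))) else 0"
  have cP: "cone (b i) (z i) \<subseteq> exps p - N" if "i < length C" for i
    using cone_partition_subset[OF C bz[OF that]] .
  have count: "int (sqfree_count p (monomial_space N :: 'k mpoly set) (carrier (poly_ring p)) j) = (\<Sum>i<length C. ?w i j)" for j
  proof -
    have "{t \<in> exps p - N. sqfree_expo t \<and> card (Poly_Mapping.keys t) = j} = (\<Union>i<length C. ?T i j)"
    proof (intro equalityI subsetI)
      fix t assume t: "t \<in> {t \<in> exps p - N. sqfree_expo t \<and> card (Poly_Mapping.keys t) = j}"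
      then obtain i where "i < length C" "t \<in> cone (b i) (z i)"
        using C unfolding cone_partition_def b_def z_def by blast
      then show "t \<in> (\<Union>i<length C. ?T i j)" using t by blast
    next
      fix t assume "t \<in> (\<Union>i<length C. ?T i j)"
      then show "t \<in> {t \<in> exps p - N. sqfree_expo t \<and> card (Poly_Mapping.keys t) = j}" using cP by blast
    qed
    also have "card \<dots> = (\<Sum>i<length C. card (?T i j))"
    proof (rule card_UN_disjoint)
      show "\<forall>i\<in>{..<length C}. finite (?T i j)"
        using cP by (intro ballI finite_subset[OF _ finite_sqfree_expos[of p]]) blast
      show "\<forall>i\<in>{..<length C}. \<forall>i'\<in>{..<length C}. i \<noteq> i' \<longrightarrow> ?T i j \<inter> ?T i' j = {}"
      proof (intro ballI impI)
        fix i i' assume i: "i \<in> {..<length C}" "i' \<in> {..<length C}" "i \<noteq> i'"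
        have "i = i'" if "t \<in> cone (b i) (z i)" "t \<in> cone (b i') (z i')" for t
        proof -
          have "t \<in> exps p - N" using cP i that by blast
          then have "\<exists>!i. i < length C \<and> t \<in> cone (b i) (z i)"
            using C unfolding cone_partition_def b_def z_def by blast
          then show ?thesis using i that by blast
        qed
        then show "?T i j \<inter> ?T i' j = {}" using i by blast
      qed
    qed simp
    finally show ?thesis
      unfolding sqfree_count_eq using fin(1) by (auto simp: card_sqfree_cone intro!: sum.cong)
  qed
  have "hbeta p (monomial_space N :: 'k mpoly set) (carrier (poly_ring p)) d k
      = (\<Sum>i<length C. \<Sum>j=0..k. (-1) ^ (k - j) * int ((d - j) choose (k - j)) * ?w i j)"
    unfolding hbeta_def count sum_distrib_left by (rule sum.swap)
  also have "\<dots> \<ge> 0"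
  proof (rule sum_nonneg)
    fix i assume "i \<in> {..<length C}"
    then have i: "i < length C" by simp
    have "d \<le> card (Poly_Mapping.keys (b i)) + card (z i - Poly_Mapping.keys (b i))"
      using fin[OF i] diff_card_le_card_Diff[of "Poly_Mapping.keys (b i)" "z i"] by simp
    then show "0 \<le> (\<Sum>j=0..k. (-1) ^ (k - j) * int ((d - j) choose (k - j)) * ?w i j)"
      using shifted_alternating_binomial_nonneg[OF k] by (cases "sqfree_expo (b i)") auto
  qed
  finally show ?thesis .
qed

lemma (in monomial_ideal) sdepth_le_hdepth:
  assumes "0 \<notin> N" and ex: "\<exists>C. cone_partition (exps p - N) C"
  shows "sdepth p (M :: ('k::field mpoly, 'k mpoly set) module) (quot_grading p (monomial_space N))
    \<le> hdepth p (monomial_space N :: 'k mpoly set) (carrier (poly_ring p))"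
proof -
  let ?dec = "stanley_decomposition p (M :: ('k mpoly, 'k mpoly set) module) (quot_grading p (monomial_space N))"
  have le: "sdepth_decomp D \<in> {d \<in> {0..p}. \<forall>k\<in>{0..d}.
      0 \<le> hbeta p (monomial_space N :: 'k mpoly set) (carrier (poly_ring p)) d k}" if D: "?dec D" for D
  proof -
    obtain C where C: "cone_partition (exps p - N) C" "map snd C = map snd D"
      using cone_partition_of_stanley_decomposition[OF D] .
    have sets: "snd ` set D = snd ` set C" using C(2) by (metis list.set_map)
    have "(0 :: expo) \<in> exps p - N" using assms(1) by simp
    then have "C \<noteq> []" using C(1) by (force simp: cone_partition_def)
    then obtain b Z where bZ: "(b, Z) \<in> set C" by (cases C) force+
    have Min: "sdepth_decomp D = Min (card ` snd ` set C)"
      unfolding sdepth_decomp_def sets[symmetric] image_image by (simp add: case_prod_beta)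
    have Z: "finite Z \<and> sdepth_decomp D \<le> card Z \<and> Z \<subseteq> {1..p}" if "(b, Z) \<in> set C" for b Z
    proof (intro conjI)
      show "Z \<subseteq> {1..p}" by (rule cone_partition_memD(2)[OF C(1) that])
      then show "finite Z" by (rule finite_subset) simp
      have "card Z \<in> card ` snd ` set C" using that by force
      then show "sdepth_decomp D \<le> card Z" unfolding Min by (intro Min_le) auto
    qed
    have "sdepth_decomp D \<le> p"
      using Z[OF bZ] card_mono[of "{1..p}" Z] by simp
    then show ?thesis using hbeta_cone_partition_nonneg[OF C(1), of "sdepth_decomp D"] Z by auto
  qed
  have fin: "finite {sdepth_decomp D |D. ?dec D}"
    using le by (auto intro: finite_subset[of _ "{0..p}"])
  \<comment> \<open>Without a Stanley decomposition, \<^const>\<open>sdepth\<close> would be the junk value \<open>Max {}\<close>.\<close>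
  have ne: "{sdepth_decomp D |D. ?dec D} \<noteq> {}"
    using ex stanley_decomposition_of_cone_partition by blast
  have "sdepth p (M :: ('k mpoly, 'k mpoly set) module) (quot_grading p (monomial_space N)) \<in> {sdepth_decomp D |D. ?dec D}"
    unfolding sdepth_def using Max_in[OF fin ne] .
  then show ?thesis
    unfolding hdepth_def using le by (intro Max_ge) auto
qed

section \<open>The intersection of two ideals of variables\<close>

lemma monomial_ideal_meeting:
  "monomial_ideal p {t \<in> exps p. Poly_Mapping.keys t \<inter> A \<noteq> {}}"
  by unfold_locales (auto simp: keys_expo_add)

lemma genideal_pvar:
  assumes "A \<subseteq> {1..p}"
  shows "Idl\<^bsub>poly_ring p\<^esub> (pvar ` A) = (monomial_space {t \<in> exps p. Poly_Mapping.keys t \<inter> A \<noteq> {}} :: 'k::field mpoly set)"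
    (is "?I = ?J")
proof
  interpret R: cring "poly_ring p :: 'k mpoly ring" by (rule cring_poly_ring)
  have J: "ideal ?J (poly_ring p)"
    by (rule monomial_ideal.ideal_monomial_space[OF monomial_ideal_meeting])
  have pv: "pvar ` A \<subseteq> ?J" using assms by (auto simp: pvar_def)
  show "?I \<subseteq> ?J" by (rule R.genideal_minimal[OF J pv])
  have "pvar ` A \<subseteq> carrier (poly_ring p :: 'k mpoly ring)"
    using assms by (auto simp: pvar_def carrier_poly_ring)
  then interpret I: ideal ?I "poly_ring p" by (rule R.genideal_ideal)
  have gen: "pvar ` A \<subseteq> ?I" unfolding genideal_def by blast
  show "?J \<subseteq> ?I"
  proof
    fix f :: "'k mpoly" assume f: "f \<in> ?J"
    have mon: "Poly_Mapping.single t c \<in> ?I" if t: "t \<in> Poly_Mapping.keys f" for t and c :: 'k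
    proof -
      obtain i where i: "i \<in> Poly_Mapping.keys t" "i \<in> A" and te: "t \<in> exps p"
        using f t by (force simp: monomial_space_def)
      define s where "s = t - Poly_Mapping.single i 1"
      have ts: "s + Poly_Mapping.single i 1 = t"
        using i(1) by (intro poly_mapping_eqI) (auto simp: s_def lookup_add lookup_minus lookup_single when_def in_keys_iff)
      then have "s \<in> exps p" using te keys_expo_add[of s "Poly_Mapping.single i 1"] by auto
      then have "Poly_Mapping.single s c \<otimes>\<^bsub>poly_ring p\<^esub> pvar i \<in> ?I"
        using gen i(2) by (intro I.I_l_closed) (auto simp: carrier_poly_ring)
      then show ?thesis by (simp only: pvar_def poly_ring_simps mult_single ts mult_1_right)
    qed
    have "(\<Sum>t\<in>B. Poly_Mapping.single t (Poly_Mapping.lookup f t)) \<in> ?I" if "B \<subseteq> Poly_Mapping.keys f" for B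
      using finite_subset[OF that finite_keys] that
    proof (induction B rule: finite_induct)
      case empty
      then show ?case using I.zero_closed by simp
    next
      case (insert t B)
      then show ?case using I.a_closed[OF mon[of t]] by simp
    qed
    then show "f \<in> ?I" by (metis order_refl sum_monomials)
  qed
qed

lemma cone_0: "cone 0 Z = {t. Poly_Mapping.keys t \<subseteq> Z}"
  by (auto simp: cone_def)

lemma cone_single:
  fixes Z :: "nat set"
  assumes "i \<in> Z"
  shows "cone (Poly_Mapping.single i 1) Z = {t. i \<in> Poly_Mapping.keys t \<and> Poly_Mapping.keys t \<subseteq> Z}"
proof (intro equalityI subsetI)
  fix t :: expo assume t: "t \<in> {t. i \<in> Poly_Mapping.keys t \<and> Poly_Mapping.keys t \<subseteq> Z}"
  define s where "s = t - Poly_Mapping.single i 1"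
  have ts: "t = Poly_Mapping.single i 1 + s"
    using t by (intro poly_mapping_eqI) (auto simp: s_def lookup_add lookup_minus lookup_single when_def in_keys_iff)
  then have "Poly_Mapping.keys s \<subseteq> Z" using t keys_expo_add[of "Poly_Mapping.single i 1" s] by auto
  then show "t \<in> cone (Poly_Mapping.single i 1) Z" using ts by (auto simp: cone_def)
qed (use assms in \<open>auto simp: cone_def keys_expo_add\<close>)

context
  fixes n m :: nat
begin

definition mixed_expos :: "expo set" where
  "mixed_expos = {t \<in> exps (n + m).
     Poly_Mapping.keys t \<inter> {1..n} \<noteq> {} \<and> Poly_Mapping.keys t \<inter> {n+1..n+m} \<noteq> {}}"

lemma monomial_ideal_mixed: "monomial_ideal (n + m) mixed_expos"
  by unfold_locales (auto simp: keys_expo_add mixed_expos_def)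

lemma ideal_eq_mixed:
  "Idl\<^bsub>poly_ring (n + m)\<^esub> (pvar ` {1..n}) \<inter> Idl\<^bsub>poly_ring (n + m)\<^esub> (pvar ` {n+1..n+m})
    = (monomial_space mixed_expos :: 'k::field mpoly set)"
proof -
  have "{1..n} \<subseteq> {1..n+m}" "{n+1..n+m} \<subseteq> {1..n+m}" by auto
  then show ?thesis
    by (simp only: genideal_pvar) (auto simp: monomial_space_def mixed_expos_def)
qed

lemma unmixed_expos:
  "exps (n + m) - mixed_expos = cone 0 {1..n} \<union> cone 0 {n+1..n+m}"
proof -
  have "Poly_Mapping.keys t \<subseteq> {1..n} \<longleftrightarrow> Poly_Mapping.keys t \<inter> {n+1..n+m} = {}"
       "Poly_Mapping.keys t \<subseteq> {n+1..n+m} \<longleftrightarrow> Poly_Mapping.keys t \<inter> {1..n} = {}"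
    if "Poly_Mapping.keys t \<subseteq> {1..n+m}" for t :: expo
    using that by fastforce+
  moreover have "Poly_Mapping.keys t \<subseteq> {1..n+m}" 
    if "Poly_Mapping.keys t \<subseteq> {1..n} \<or> Poly_Mapping.keys t \<subseteq> {n+1..n+m}" for t :: expo
    using that by fastforce
  ultimately show ?thesis unfolding mixed_expos_def cone_0 by blast
qed

text \<open>Monomials in the second group of variables are sorted by their least variable.\<close>

lemma ex_cone_partition_unmixed: "\<exists>C. cone_partition (exps (n + m) - mixed_expos) C"
proof
  let ?C = "(0, {1..n}) # map (\<lambda>i. (Poly_Mapping.single (n + Suc i) 1, {n + Suc i..n+m})) [0..<m]"
  have cone: "cone (Poly_Mapping.single (n + Suc i) 1) {n + Suc i..n+m}
      = {t. n + Suc i \<in> Poly_Mapping.keys t \<and> Poly_Mapping.keys t \<subseteq> {n + Suc i..n+m}}" if "i < m" for i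
    using that by (intro cone_single) auto
  show "cone_partition (exps (n + m) - mixed_expos) ?C"
    unfolding cone_partition_def unmixed_expos
  proof (intro conjI ballI)
    fix bZ :: "expo \<times> nat set" assume "bZ \<in> set ?C"
    then show "case bZ of (b, Z) \<Rightarrow> cone b Z \<subseteq> cone 0 {1..n} \<union> cone 0 {n+1..n+m}"
      by (auto simp: cone[simplified] cone_0) fastforce+
  next
    fix t assume t: "t \<in> cone 0 {1..n} \<union> cone 0 {n+1..n+m}"
    have idx: "i < length ?C \<and> t \<in> cone (fst (?C ! i)) (snd (?C ! i)) \<longleftrightarrow>
       (case i of 0 \<Rightarrow> Poly_Mapping.keys t \<subseteq> {1..n} | Suc j \<Rightarrow> j < m \<and>
         n + Suc j \<in> Poly_Mapping.keys t \<and> Poly_Mapping.keys t \<subseteq> {n + Suc j..n+m})" for i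
      by (cases i) (simp_all add: cone_0 cone[simplified] cong: conj_cong)
    show "\<exists>!i. i < length ?C \<and> t \<in> cone (fst (?C ! i)) (snd (?C ! i))"
      unfolding idx
    proof (cases "Poly_Mapping.keys t \<subseteq> {1..n}")
      case True
      then show "\<exists>!i. case i of 0 \<Rightarrow> Poly_Mapping.keys t \<subseteq> {1..n} | Suc j \<Rightarrow> j < m \<and>
         n + Suc j \<in> Poly_Mapping.keys t \<and> Poly_Mapping.keys t \<subseteq> {n + Suc j..n+m}"
        by (intro ex1I[of _ 0]) (auto split: nat.splits dest: subsetD)
    next
      case False
      then have k: "Poly_Mapping.keys t \<subseteq> {n+1..n+m}" "Poly_Mapping.keys t \<noteq> {}" using t by (auto simp: cone_0)
      define l where "l = Min (Poly_Mapping.keys t)"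
      have l: "l \<in> Poly_Mapping.keys t" "\<And>x. x \<in> Poly_Mapping.keys t \<Longrightarrow> l \<le> x"
        using k(2) by (auto simp: l_def)
      then have "l \<in> {n+1..n+m}" using k(1) by blast
      then obtain j where j: "l = n + Suc j" "j < m"
        using le_Suc_ex[of "n+1" l] by auto
      show "\<exists>!i. case i of 0 \<Rightarrow> Poly_Mapping.keys t \<subseteq> {1..n} | Suc j \<Rightarrow> j < m \<and>
         n + Suc j \<in> Poly_Mapping.keys t \<and> Poly_Mapping.keys t \<subseteq> {n + Suc j..n+m}"
      proof (rule ex1I[of _ "Suc j"])
        show "case Suc j of 0 \<Rightarrow> Poly_Mapping.keys t \<subseteq> {1..n} | Suc j \<Rightarrow> j < m \<and>
         n + Suc j \<in> Poly_Mapping.keys t \<and> Poly_Mapping.keys t \<subseteq> {n + Suc j..n+m}"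
          using j l k(1) by fastforce
      next
        fix i assume "case i of 0 \<Rightarrow> Poly_Mapping.keys t \<subseteq> {1..n} | Suc j \<Rightarrow> j < m \<and>
         n + Suc j \<in> Poly_Mapping.keys t \<and> Poly_Mapping.keys t \<subseteq> {n + Suc j..n+m}"
        then obtain j' where j': "i = Suc j'" "n + Suc j' \<in> Poly_Mapping.keys t" "Poly_Mapping.keys t \<subseteq> {n + Suc j'..n+m}"
          using False by (cases i) auto
        then have "n + Suc j' = l" using l by (intro antisym) auto
        then show "i = Suc j" using j' j by simp
      qed
    qed
  qed
qed

lemma sqfree_count_unmixed:
  "sqfree_count (n + m) (monomial_space mixed_expos :: 'k::field mpoly set) (carrier (poly_ring (n + m))) j
    = (if j = 0 then 1 else (n choose j) + (m choose j))"
proof -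
  define T where "T Z = {t \<in> cone 0 Z. sqfree_expo t \<and> card (Poly_Mapping.keys t) = j}" for Z
  have card: "card (T Z) = card Z choose j" if "finite Z" for Z
    using card_sqfree_cone[OF that, of 0 j] by (simp add: T_def sqfree_expo_def)
  have "{t \<in> exps (n + m) - mixed_expos. sqfree_expo t \<and> card (Poly_Mapping.keys t) = j}
      = T {1..n} \<union> T {n+1..n+m}"
    unfolding unmixed_expos T_def by blast
  then have count: "sqfree_count (n + m) (monomial_space mixed_expos :: 'k mpoly set) (carrier (poly_ring (n + m))) j
      = card (T {1..n} \<union> T {n+1..n+m})"
    by (simp add: sqfree_count_eq)
  show ?thesis
  proof (cases "j = 0")
    case True
    then have "T Z = {0}" for Z by (auto simp: T_def cone_0 sqfree_expo_def)
    then show ?thesis using count True by simp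
  next
    case False
    have T: "finite (T Z)" if "Z \<subseteq> {1..n+m}" for Z
      using that by (intro finite_subset[OF _ finite_sqfree_expos[of "n + m"]]) (auto simp: T_def cone_0)
    then have fin: "finite (T {1..n})" "finite (T {n+1..n+m})"
      by (auto intro!: T)
    have "T {1..n} \<inter> T {n+1..n+m} = {}"
    proof (rule equals0I)
      fix t assume "t \<in> T {1..n} \<inter> T {n+1..n+m}"
      then have "Poly_Mapping.keys t \<subseteq> {1..n}" "Poly_Mapping.keys t \<subseteq> {n+1..n+m}" and j: "card (Poly_Mapping.keys t) = j"
        by (simp_all add: T_def cone_0)
      then have "Poly_Mapping.keys t = {}" by fastforce
      then show False using False j by (metis card.empty)
    qed
    then show ?thesis using count False fin by (simp add: card_Un_disjoint card)
  qed
qed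

lemma hdepth_unmixed_bounds:
  defines "d \<equiv> hdepth (n + m) (monomial_space mixed_expos :: 'k::field mpoly set) (carrier (poly_ring (n + m)))"
  shows "d \<le> n + m" "2 \<le> d \<Longrightarrow>
    0 \<le> int d * int d - int d * (2 * int n + 2 * int m + 1) + int n * int n + int m * int m + int n + int m"
proof -
  let ?S = "{d \<in> {0..n+m}. \<forall>k\<in>{0..d}. 0 \<le> hbeta (n + m)
    (monomial_space mixed_expos :: 'k mpoly set) (carrier (poly_ring (n + m))) d k}"
  have "0 \<in> ?S" by (auto simp: hbeta_def)
  then have d: "d \<in> ?S" unfolding d_def hdepth_def by (intro Max_in) auto
  then show "d \<le> n + m" by simp
  have c2: "2 * int (a choose 2) = int a * int a - int a" for a
  proof -
    have "2 * (a choose 2) = a * (a - 1)"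
      by (cases a) (simp_all add: choose_two)
    then have "2 * int (a choose 2) = int (a * (a - 1))" by (metis of_nat_mult of_nat_numeral)
    then show ?thesis by (cases a) (simp_all add: algebra_simps)
  qed
  assume "2 \<le> d"
  then have "0 \<le> hbeta (n + m) (monomial_space mixed_expos :: 'k mpoly set) (carrier (poly_ring (n + m))) d 2"
    using d by auto
  also have "\<dots> = int (d choose 2) - int (d - 1) * int (n + m) + int (n choose 2) + int (m choose 2)"
    by (simp add: hbeta_def sqfree_count_unmixed eval_nat_numeral)
  finally have "0 \<le> 2 * int (d choose 2) - 2 * (int (d - 1) * int (n + m)) + 2 * int (n choose 2) + 2 * int (m choose 2)"
    by linarith
  moreover have "int (d - 1) = int d - 1" using \<open>2 \<le> d\<close> by simp
  ultimately show "0 \<le> int d * int d - int d * (2 * int n + 2 * int m + 1) + int n * int n + int m * int m + int n + int m"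
    unfolding c2 by (simp add: algebra_simps)
qed

end

lemma hdepth_bound_real:
  fixes d n m :: nat
  assumes "m \<ge> 1" "n \<ge> 1" "d \<le> n + m"
    and q: "2 \<le> d \<Longrightarrow> 0 \<le> int d * int d - int d * (2 * int n + 2 * int m + 1) + int n * int n + int m * int m + int n + int m"
  shows "real d \<le> real n + real m + 1/2 - sqrt (2 * real m * real n + 1/4)"
proof -
  have sq: "real n \<le> real n * real n" "real m \<le> real m * real m"
    using assms(1,2) by (simp_all add: mult_le_cancel_left1)
  have "0 \<le> real d * real d - real d * (2 * real n + 2 * real m + 1) + real n * real n + real m * real m + real n + real m"
  proof (cases "2 \<le> d")
    case True
    from q[OF True] have "0 \<le> real_of_int (int d * int d - int d * (2 * int n + 2 * int m + 1) + int n * int n + int m * int m + int n + int m)"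
      by (simp only: of_int_0_le_iff)
    then show ?thesis by simp
  next
    case False
    then have "d = 0 \<or> d = 1" by auto
    then show ?thesis using sq by auto
  qed
  then have "2 * real m * real n + 1/4 \<le> (real n + real m + 1/2 - real d)\<^sup>2"
    by (simp add: power2_eq_square algebra_simps)
  then have "sqrt (2 * real m * real n + 1/4) \<le> \<bar>real n + real m + 1/2 - real d\<bar>"
    by (metis real_sqrt_abs real_sqrt_le_mono)
  moreover have "real d \<le> real n + real m" using assms(3) by linarith
  ultimately show ?thesis by linarith
qed

lemma hdepth_bound_strict:
  fixes d n m :: nat
  assumes "n \<ge> m" "m \<ge> 1" "n \<le> 2 * m - 2" "d \<le> n + m"
    and q: "2 \<le> d \<Longrightarrow> 0 \<le> int d * int d - int d * (2 * int n + 2 * int m + 1) + int n * int n + int m * int m + int n + int m"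
  shows "d < m"
proof (rule ccontr)
  assume "\<not> d < m"
  then have "d \<ge> m" by simp
  have m: "m \<ge> 2" using assms by linarith
  define e where "e = int d - int m"
  have e: "0 \<le> e" "e \<le> int n" using \<open>d \<ge> m\<close> assms(4) by (auto simp: e_def)
  have d: "int d = int m + e" by (simp add: e_def)
  have "0 \<le> int n * (int n - 2 * int m + 1) + e * (e - 2 * int n - 1)"
    using q \<open>d \<ge> m\<close> m unfolding d by (simp add: algebra_simps)
  moreover have "int n * (int n - 2 * int m + 1) < 0"
    using assms m by (intro mult_pos_neg) auto
  moreover have "e * (e - 2 * int n - 1) \<le> 0"
    using e by (intro mult_nonneg_nonpos) auto
  ultimately show False by linarith
qed

theorem theorem2p6:
  fixes n m :: nat and S :: "'k::field mpoly ring" and I :: "'k mpoly set"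
  assumes "n \<ge> m" and "m \<ge> 1"
    and "S = poly_ring (n + m)"
    and "I = Idl\<^bsub>S\<^esub> (pvar ` {1..n}) \<inter> Idl\<^bsub>S\<^esub> (pvar ` {n+1..n+m})"
  shows "sdepth (n + m) (quot_module S I) (quot_grading (n + m) I) \<le> hdepth (n + m) I (carrier S)
    \<and> int (hdepth (n + m) I (carrier S))
        \<le> \<lfloor>real n + real m + 1/2 - sqrt (2 * real m * real n + 1/4)\<rfloor>
    \<and> (n \<le> 2 * m - 2 \<longrightarrow> hdepth (n + m) I (carrier S) < m)"
proof -
  have I: "I = monomial_space (mixed_expos n m)"
    unfolding assms(4,3) by (rule ideal_eq_mixed)
  interpret monomial_ideal "n + m" "mixed_expos n m" by (rule monomial_ideal_mixed)
  have "0 \<notin> mixed_expos n m" by (simp add: mixed_expos_def)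
  then have "sdepth (n + m) (quot_module S I) (quot_grading (n + m) I) \<le> hdepth (n + m) I (carrier S)"
    unfolding I assms(3) by (rule sdepth_le_hdepth[OF _ ex_cone_partition_unmixed])
  moreover note h = hdepth_unmixed_bounds[of n m, where 'k = 'k, folded I assms(3)]
  moreover have "real (hdepth (n + m) I (carrier S)) \<le> real n + real m + 1/2 - sqrt (2 * real m * real n + 1/4)"
    using assms(1,2) h by (intro hdepth_bound_real) auto
  then have "int (hdepth (n + m) I (carrier S)) \<le> \<lfloor>real n + real m + 1/2 - sqrt (2 * real m * real n + 1/4)\<rfloor>"
    by (simp add: le_floor_iff)
  moreover have "n \<le> 2 * m - 2 \<longrightarrow> hdepth (n + m) I (carrier S) < m"
    using hdepth_bound_strict[OF assms(1,2) _ h] by blast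
  ultimately show ?thesis by blast
qed

end
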